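(* Let $U$ and $V$ be real Hilbert spaces, $L:U\to V$ a bounded linear operator, $y\in\mathcal R(L)$, and let $u^\dagger$ denote the minimum-norm solution of $Lu=y$. Then: (i) for every $\nu\in(0,2]$, the standard source condition with parameter $\nu$ implies the symmetrized variational inequality with the same parameter $\nu$; (ii) the symmetrized variational inequality with parameter $\nu=2$ is equivalent to the standard source condition with parameter $\nu=2$.
   Context: $\mathcal R(T)$ denotes the range of an operator $T$. For $y\in\mathcal R(L)$, the minimum-norm solution $u^\dagger\in U$ is the unique element with $Lu^\dagger=y$ and $\|u^\dagger\|=\inf\{\|u\|:Lu=y\}$. Powers $(L^*L)^r$, $r>0$, are defined by functional calculus. The following conditions on the problem $Lu=y$ are used. Standard source condition with parameter $\nu\in(0,2]$: $u^\dagger\in\mathcal R((L^*L)^{\frac\nu2})$. Symmetrized variational inequality with parameter $\nu\in(0,2]$: there exists $\beta\ge0$ such that $2\langle u^\dagger,u\rangle\le\beta\|L^*Lu\|^{\frac\nu2}\|u\|^{1-\frac\nu2}$ for every $u\in U$ (for $\nu=2$ the factor $\|u\|^{0}$ is read as $1$). *)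

theory Defs
  imports "HOL-Analysis.Analysis" "HOL-Computational_Algebra.Polynomial"
begin

definition is_min_norm_solution ::
    "('u::real_inner \<Rightarrow> 'v::real_inner) \<Rightarrow> 'v \<Rightarrow> 'u \<Rightarrow> bool" where
  "is_min_norm_solution L y u \<longleftrightarrow> L u = y \<and> norm u = Inf {norm u' | u'. L u' = y}"

definition min_norm_solution ::
    "('u::real_inner \<Rightarrow> 'v::real_inner) \<Rightarrow> 'v \<Rightarrow> 'u" where
  "min_norm_solution L y = (THE u. is_min_norm_solution L y u)"

definition poly_op :: "real poly \<Rightarrow> ('u::real_inner \<Rightarrow> 'u) \<Rightarrow> 'u \<Rightarrow> 'u" where
  "poly_op p A u = (\<Sum>i\<le>degree p. coeff p i *\<^sub>R (A ^^ i) u)"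

(* Continuous functional calculus of a bounded positive self-adjoint operator A, for f continuous
   on the interval [0, onorm A], which contains the spectrum of A: f(A) is the limit in operator
   norm of p_n(A), for every sequence of real polynomials p_n converging to f uniformly on this
   interval. Existence and uniqueness of the limit hold only under these conditions on A (on a
   complete space) and f; outside of them the value is meaningless. *)
definition fun_calc ::
    "(real \<Rightarrow> real) \<Rightarrow> ('u::real_inner \<Rightarrow> 'u) \<Rightarrow> 'u \<Rightarrow> 'u" where
  "fun_calc f A = (THE B. bounded_linear B \<and>
     (\<forall>p. uniform_limit {0..onorm A} (\<lambda>n. poly (p n)) f sequentially \<longrightarrow>
        (\<lambda>n. onorm (\<lambda>u. poly_op (p n) A u - B u)) \<longlonglongrightarrow> 0))"

(* Meant for r > 0; then 0 powr r = 0, so the function is continuous at 0. *)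
definition op_powr :: "('u::real_inner \<Rightarrow> 'u) \<Rightarrow> real \<Rightarrow> 'u \<Rightarrow> 'u" where
  "op_powr A r = fun_calc (\<lambda>t. t powr r) A"

(* The library's adjoint is a choice operator; for bounded linear L between complete spaces
   the adjoint exists and is unique. *)
definition source_condition ::
    "('u::real_inner \<Rightarrow> 'v::real_inner) \<Rightarrow> 'u \<Rightarrow> real \<Rightarrow> bool" where
  "source_condition L udag \<nu> \<longleftrightarrow> udag \<in> range (op_powr (adjoint L \<circ> L) (\<nu> / 2))"

(* For \<nu> = 2 the factor (norm u) to the power 0 is 1, whereas 0 powr 0 = 0. *)
definition symmetrized_vi ::
    "('u::real_inner \<Rightarrow> 'v::real_inner) \<Rightarrow> 'u \<Rightarrow> real \<Rightarrow> bool" where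
  "symmetrized_vi L udag \<nu> \<longleftrightarrow>
     (\<exists>\<beta>\<ge>0. \<forall>u. 2 * (udag \<bullet> u) \<le>
        \<beta> * norm (adjoint L (L u)) powr (\<nu> / 2) *
          (if \<nu> = 2 then 1 else norm u powr (1 - \<nu> / 2)))"

end

theory Submission
  imports Defs "HOL-Computational_Algebra.Fundamental_Theorem_Algebra"
begin

text \<open>
  With \<open>A = L\<^sup>*L\<close> and \<open>r = \<nu> / 2\<close>, a source element \<open>A\<^sup>r w\<close> satisfies
  \<open>A\<^sup>r w \<bullet> u = w \<bullet> A\<^sup>r u\<close>, so (i) is the interpolation inequality
  \<open>\<parallel>A\<^sup>r u\<parallel> \<le> \<parallel>A u\<parallel>\<^sup>r \<parallel>u\<parallel>\<^sup>1\<^sup>-\<^sup>r\<close>. This in turn follows by bounding \<open>t\<^sup>2\<^sup>r\<close> by quadratic polynomials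
  in \<open>t\<close>, because the functional calculus preserves order. For the converse at \<open>\<nu> = 2\<close>, the
  inequality says that \<open>A u \<mapsto> x \<bullet> u\<close> is a well-defined bounded functional on the range of \<open>A\<close>, so it
  is represented by some \<open>w\<close>, and \<open>x = A w\<close>.
\<close>

section \<open>Riesz representation and the adjoint\<close>

text \<open>A Riesz argument on the closure of the range of \<open>T\<close>: minimise the energy
  \<open>J\<close>. A minimising sequence has Cauchy images under \<open>T\<close>, and the first
  variation shows that their limit \<open>w\<close> represents \<open>f\<close>. With
  \<open>T\<close> the identity this yields adjoints, with \<open>T = A\<close> the converse at
  \<open>\<nu> = 2\<close>.\<close>

lemma functional_factors_through_range:
  fixes T :: "'a::real_vector \<Rightarrow> 'b::{real_inner, complete_space}" and f :: "'a \<Rightarrow> real"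
  assumes "linear T" "linear f" and bound: "\<And>u. \<bar>f u\<bar> \<le> C * norm (T u)"
  shows "\<exists>w. \<forall>u. f u = w \<bullet> T u"
proof -
  interpret T: linear T by fact
  interpret f: linear f by fact
  define J where "J u = (norm (T u))\<^sup>2 - 2 * f u" for u
  have lower: "- C\<^sup>2 \<le> J u" for u
  proof -
    have "0 \<le> (norm (T u) - C)\<^sup>2" by simp
    also have "\<dots> = (norm (T u))\<^sup>2 - 2 * (C * norm (T u)) + C\<^sup>2"
      by (simp add: power2_diff)
    finally show ?thesis using bound[of u] by (simp add: J_def)
  qed
  define m where "m = Inf (range J)"
  have bdd: "bdd_below (range J)" using lower by (auto intro!: bdd_belowI2)
  have m_le: "m \<le> J u" for u unfolding m_def by (rule cInf_lower[OF _ bdd]) simp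
  have "\<exists>u. J u < m + 1 / real (Suc n)" for n
  proof (rule ccontr)
    assume "\<not> ?thesis"
    then have "m + 1 / real (Suc n) \<le> m"
      by (subst (2) m_def, intro cInf_greatest) (auto simp: not_less)
    then show False by simp
  qed
  then obtain x where x: "\<And>n. J (x n) < m + 1 / real (Suc n)" by metis
  \<comment> \<open>The linear part of \<open>J\<close> cancels, leaving the parallelogram law.
    Midpoint values are at least \<open>m\<close>, so nearly minimal points have nearby images; the
    margins \<open>e\<^sup>2 / 4\<close> below add up to \<open>e\<^sup>2\<close>.\<close>
  have parallelogram: "(norm (T u - T v))\<^sup>2 = 2 * J u + 2 * J v - 4 * J ((1/2) *\<^sub>R (u + v))" for u v
    by (simp add: J_def T.scale T.add f.scale f.add power2_norm_eq_inner algebra_simps inner_commute)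
  have cauchy: "Cauchy (\<lambda>n. T (x n))"
  proof (rule metric_CauchyI)
    fix e :: real assume "e > 0"
    then obtain N where N: "1 / real (Suc N) < e\<^sup>2 / 4"
      using nat_approx_posE[of "e\<^sup>2 / 4"] by auto
    have close: "J (x n) < m + e\<^sup>2 / 4" if "n \<ge> N" for n
    proof -
      have "1 / real (Suc n) \<le> 1 / real (Suc N)" using that by (intro divide_left_mono) auto
      then show ?thesis using x[of n] N by linarith
    qed
    show "\<exists>M. \<forall>k\<ge>M. \<forall>n\<ge>M. dist (T (x k)) (T (x n)) < e"
    proof (intro exI[of _ N] allI impI)
      fix k n assume "k \<ge> N" "n \<ge> N"
      then have "(norm (T (x k) - T (x n)))\<^sup>2 < e\<^sup>2"
        using close[of k] close[of n] m_le[of "(1/2) *\<^sub>R (x k + x n)"] parallelogram[of "x k" "x n"] by linarith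
      then show "dist (T (x k)) (T (x n)) < e"
        using \<open>e > 0\<close> by (simp add: dist_norm power_less_imp_less_base)
    qed
  qed
  then obtain w where w: "(\<lambda>n. T (x n)) \<longlonglongrightarrow> w" using Cauchy_convergent convergent_def by blast
  have "f v = w \<bullet> T v" for v
  proof -
    define d where "d = w \<bullet> T v - f v"
    \<comment> \<open>First variation: perturb the minimising sequence by \<open>t\<close> times
      \<open>v\<close> and let \<open>n\<close> tend to infinity.\<close>
    have quad: "0 \<le> t\<^sup>2 * (norm (T v))\<^sup>2 + 2 * t * d" for t
    proof -
      have "- (1 / real (Suc n)) \<le> t\<^sup>2 * (norm (T v))\<^sup>2 + 2 * t * (T (x n) \<bullet> T v - f v)" for n
      proof -
        have "J (x n + t *\<^sub>R v) = J (x n) + (t\<^sup>2 * (norm (T v))\<^sup>2 + 2 * t * (T (x n) \<bullet> T v - f v))"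
          unfolding J_def power2_norm_eq_inner
          by (simp add: T.scale T.add f.scale f.add inner_commute power2_eq_square algebra_simps)
        then show ?thesis using x[of n] m_le[of "x n + t *\<^sub>R v"] by linarith
      qed
      moreover have "(\<lambda>n. - (1 / real (Suc n))) \<longlonglongrightarrow> - 0"
        by (intro tendsto_minus LIMSEQ_Suc lim_1_over_n)
      moreover have "(\<lambda>n. t\<^sup>2 * (norm (T v))\<^sup>2 + 2 * t * (T (x n) \<bullet> T v - f v))
          \<longlonglongrightarrow> t\<^sup>2 * (norm (T v))\<^sup>2 + 2 * t * d"
        unfolding d_def by (intro tendsto_intros w)
      ultimately show ?thesis by (auto intro: LIMSEQ_le)
    qed
    have "d = 0"
    proof -
      \<comment> \<open>The value \<open>t = - d / K\<close> minimises the quadratic with leading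
        coefficient \<open>K\<close>; adding 1 keeps \<open>K\<close> positive when
        \<open>T v = 0\<close>.\<close>
      define K where "K = (norm (T v))\<^sup>2 + 1"
      have K: "K > 0" by (simp add: K_def add_nonneg_pos)
      have "0 \<le> (- d / K)\<^sup>2 * (norm (T v))\<^sup>2 + 2 * (- d / K) * d" by (rule quad)
      also have "\<dots> \<le> (- d / K)\<^sup>2 * K + 2 * (- d / K) * d"
        by (intro add_right_mono mult_left_mono) (auto simp: K_def)
      also have "\<dots> = - (d\<^sup>2 / K)" using K by (simp add: power2_eq_square field_simps)
      finally show ?thesis using K by (simp add: divide_le_0_iff)
    qed
    then show ?thesis by (simp add: d_def)
  qed
  then show ?thesis by blast
qed

text \<open>\<open>adjoint\<close> chooses a function with this identity, so it suffices that one
  exists: for fixed \<open>y\<close>, the bounded functional \<open>L x \<bullet> y\<close> of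
  \<open>x\<close> is represented by a vector.\<close>

lemma bounded_linear_inner_adjoint:
  fixes L :: "'u::{real_inner, complete_space} \<Rightarrow> 'v::real_inner"
  assumes "bounded_linear L"
  shows "L x \<bullet> y = x \<bullet> adjoint L y"
proof -
  interpret bounded_linear L by fact
  have "\<exists>w. \<forall>x. L x \<bullet> y = w \<bullet> x" for y
  proof -
    have "\<bar>L x \<bullet> y\<bar> \<le> (onorm L * norm y) * norm x" for x
      using Cauchy_Schwarz_ineq2[of "L x" y] mult_right_mono[OF onorm[OF assms, of x], of "norm y"]
      by (simp add: mult_ac)
    then show ?thesis
      by (intro functional_factors_through_range[where T = "\<lambda>x. x"])
        (auto intro!: linearI simp: add scaleR inner_add_left)
  qed
  then have "\<exists>g. \<forall>x y. L x \<bullet> y = x \<bullet> g y" by (metis inner_commute)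
  then have "\<forall>x y. L x \<bullet> y = x \<bullet> adjoint L y" unfolding adjoint_def by (rule someI_ex)
  then show ?thesis by blast
qed

section \<open>Factorisation of real polynomials\<close>

text \<open>By the fundamental theorem of algebra \<open>q\<close> has a complex root
  \<open>z\<close>. The real minimal polynomial \<open>g\<close> of \<open>z\<close> divides
  \<open>q\<close>, since the remainder has smaller degree than \<open>g\<close> and still vanishes
  at \<open>z\<close>.\<close>

lemma real_poly_factor:
  fixes q :: "real poly"
  assumes "degree q > 0"
  shows "\<exists>g h. q = g * h \<and> degree h < degree q \<and>
    ((\<exists>r. g = [:- r, 1:]) \<or> (\<exists>a b. b \<noteq> 0 \<and> g = [:a\<^sup>2 + b\<^sup>2, - 2 * a, 1:]))"
proof -
  have hom: "poly (map_poly complex_of_real (g * h)) z =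
      poly (map_poly of_real g) z * poly (map_poly of_real h) z"
    "poly (map_poly complex_of_real (g + h)) z =
      poly (map_poly of_real g) z + poly (map_poly of_real h) z" for g h z
  proof -
    show add: "poly (map_poly complex_of_real (g + h)) z =
      poly (map_poly of_real g) z + poly (map_poly of_real h) z" for g h
      by (induction g h rule: poly_induct2) (auto simp: map_poly_pCons algebra_simps)
    have smult: "poly (map_poly complex_of_real (smult c h)) z = of_real c * poly (map_poly of_real h) z" for c h
      by (induction h) (auto simp: map_poly_pCons algebra_simps)
    show "poly (map_poly complex_of_real (g * h)) z =
      poly (map_poly of_real g) z * poly (map_poly of_real h) z"
      by (induction g) (auto simp: map_poly_pCons add smult algebra_simps)
  qed
  have "degree (map_poly complex_of_real q) = degree q" by (simp add: degree_map_poly)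
  then obtain z where z: "poly (map_poly of_real q) z = (0::complex)"
    using assms fundamental_theorem_of_algebra_alt[of "map_poly complex_of_real q"] by fastforce
  define g where "g = (if Im z = 0 then [:- Re z, 1:] else [:(Re z)\<^sup>2 + (Im z)\<^sup>2, - 2 * Re z, 1:])"
  have "poly (map_poly of_real g) z = 0"
    by (auto simp: g_def map_poly_pCons complex_eq_iff power2_eq_square algebra_simps)
  moreover have "poly (map_poly of_real (q div g * g + q mod g)) z = 0"
    using z by (simp only: div_mult_mod_eq)
  ultimately have rem_root: "poly (map_poly of_real (q mod g)) z = 0"
    by (simp only: hom mult_zero_right add_0_left)
  have "g \<noteq> 0" by (simp add: g_def)
  have "q mod g = 0"
  proof (cases "Im z = 0")
    case True
    then have "degree (q mod g) = 0"
      using degree_mod_less[OF \<open>g \<noteq> 0\<close>, of q] by (auto simp: g_def)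
    then obtain c where "q mod g = [:c:]" by (rule degree_eq_zeroE)
    then show ?thesis using rem_root by (simp add: map_poly_pCons)
  next
    case False
    then have "degree (q mod g) \<le> 1"
      using degree_mod_less[OF \<open>g \<noteq> 0\<close>, of q] by (auto simp: g_def)
    then obtain c d where cd: "q mod g = [:c, d:]" by (metis degree1_coeffs le_neq_implies_less less_one degree_eq_zeroE pCons_0_0)
    \<comment> \<open>For non-real \<open>z\<close>, the imaginary part of
      \<open>c + d * z = 0\<close> forces \<open>d = 0\<close>, and then
      \<open>c = 0\<close>.\<close>
    then show ?thesis using rem_root False by (auto simp: map_poly_pCons complex_eq_iff)
  qed
  then have q: "q = g * (q div g)" by (metis dvd_mult_div_cancel mod_0_imp_dvd)
  moreover have "degree (q div g) < degree q"
  proof -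
    have "q div g \<noteq> 0" using assms q by auto
    then have "degree q = degree g + degree (q div g)"
      using q \<open>g \<noteq> 0\<close> degree_mult_eq by metis
    moreover have "degree g > 0" by (simp add: g_def)
    ultimately show ?thesis by simp
  qed
  moreover have "(\<exists>r. g = [:- r, 1:]) \<or> (\<exists>a b. b \<noteq> 0 \<and> g = [:a\<^sup>2 + b\<^sup>2, - 2 * a, 1:])"
    by (auto simp: g_def)
  ultimately show ?thesis by blast
qed

section \<open>Polynomials in a linear operator\<close>

lemma poly_op_0 [simp]: "poly_op 0 A u = 0"
  by (simp add: poly_op_def)

lemma poly_op_pCons:
  assumes "linear A"
  shows "poly_op (pCons a p) A u = a *\<^sub>R u + A (poly_op p A u)"
\<comment> \<open>\<open>pCons a p\<close> has degree \<open>Suc (degree p)\<close> only for nonzero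
  \<open>p\<close>.\<close>
proof (cases "p = 0")
  case True
  then show ?thesis using linear_0[OF assms] by (simp add: poly_op_def)
next
  case False
  then show ?thesis
    using linear_scale[OF assms]
    by (simp add: poly_op_def sum.atMost_Suc_shift linear_sum[OF assms] del: sum.atMost_Suc)
qed

lemma bounded_linear_poly_op:
  assumes "bounded_linear A"
  shows "bounded_linear (poly_op p A)"
proof (induction p)
  case 0
  have "poly_op 0 A = (\<lambda>u. 0)" by (simp add: fun_eq_iff)
  then show ?case by simp
next
  case (pCons a p)
  have "poly_op (pCons a p) A = (\<lambda>u. a *\<^sub>R u + A (poly_op p A u))"
    by (simp add: fun_eq_iff poly_op_pCons[OF bounded_linear.linear[OF assms]])
  then show ?case
    by (auto intro!: bounded_linear_add bounded_linear_compose[OF assms] pCons.IH bounded_linear_scaleR_right)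
qed

lemma poly_op_add: "poly_op (p + q) A u = poly_op p A u + poly_op q A u" if "linear A"
  by (induction p q rule: poly_induct2)
    (auto simp: poly_op_pCons[OF that] linear_add[OF that] algebra_simps)

lemma poly_op_smult: "poly_op (smult c p) A u = c *\<^sub>R poly_op p A u" if "linear A"
  by (induction p) (auto simp: poly_op_pCons[OF that] linear_scale[OF that] algebra_simps)

lemma poly_op_diff: "poly_op (p - q) A u = poly_op p A u - poly_op q A u" if "linear A"
  using poly_op_add[OF that, of p "- q"] poly_op_smult[OF that, of "-1" q] by simp

lemma poly_op_mult: "poly_op (p * q) A u = poly_op p A (poly_op q A u)" if "linear A"
  by (induction p)
    (auto simp: poly_op_pCons[OF that] poly_op_add[OF that] poly_op_smult[OF that])

section \<open>Positive self-adjoint operators: norm and order bounds for polynomials\<close>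

locale positive_operator =
  fixes A :: "'u::{real_inner, complete_space} \<Rightarrow> 'u"
  assumes bounded_linear: "bounded_linear A"
    and self_adjoint: "A x \<bullet> y = x \<bullet> A y"
    and nonneg: "0 \<le> A x \<bullet> x"
begin

lemma linear: "linear A"
  by (rule bounded_linear.linear[OF bounded_linear])

lemmas poly_op_simps = poly_op_pCons[OF linear] poly_op_add[OF linear] poly_op_smult[OF linear]
  poly_op_diff[OF linear] poly_op_mult[OF linear] linear_0[OF linear]

lemma bounded_linear_poly [intro]: "bounded_linear (poly_op p A)"
  by (rule bounded_linear_poly_op[OF bounded_linear])

lemma poly_op_self_adjoint: "poly_op p A x \<bullet> y = x \<bullet> poly_op p A y"
proof (induction p arbitrary: x y)
  case (pCons a p)
  \<comment> \<open>\<open>A\<close> is itself the polynomial \<open>[:0, 1:]\<close> in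
    \<open>A\<close>, so commutation comes from that of polynomials.\<close>
  have "A (poly_op p A x) = poly_op p A (A x)" for x
  proof -
    have "poly_op ([:0, 1:] * p) A x = poly_op (p * [:0, 1:]) A x" by (simp only: mult.commute)
    then show ?thesis unfolding poly_op_mult[OF linear] by (simp add: poly_op_simps)
  qed
  then show ?case
    by (simp add: poly_op_simps inner_add_left inner_add_right pCons.IH self_adjoint)
qed simp

text \<open>An elementary substitute for locating the spectrum: positivity handles
  \<open>r < 0\<close>, the triangle inequality handles \<open>r > onorm A\<close>.\<close>

lemma shift_bounded_below:
  assumes "r \<notin> {0..onorm A}"
  shows "\<exists>c>0. \<forall>x. c * norm x \<le> norm (A x - r *\<^sub>R x)"
proof (cases "r < 0")
  case True
  have "- r * norm x \<le> norm (A x - r *\<^sub>R x)" for x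
  proof -
    have "- r * norm x * norm x \<le> (A x - r *\<^sub>R x) \<bullet> x"
      using nonneg[of x] by (simp add: inner_diff_left dot_square_norm power2_eq_square)
    also have "\<dots> \<le> norm (A x - r *\<^sub>R x) * norm x" by (rule norm_cauchy_schwarz)
    finally show ?thesis by (cases "x = 0") (auto intro: mult_right_le_imp_le)
  qed
  then show ?thesis using True by (intro exI[of _ "- r"]) auto
next
  case False
  with assms have r: "r > onorm A" "r \<ge> 0" by auto
  have "(r - onorm A) * norm x \<le> norm (A x - r *\<^sub>R x)" for x
  proof -
    have "norm (r *\<^sub>R x) \<le> norm (A x) + norm (A x - r *\<^sub>R x)"
      using norm_triangle_ineq4[of "A x" "A x - r *\<^sub>R x"] by simp
    then show ?thesis using onorm[OF bounded_linear, of x] r by (simp add: algebra_simps)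
  qed
  then show ?thesis using r by (intro exI[of _ "r - onorm A"]) auto
qed

text \<open>The quadratic is \<open>(t - a)\<^sup>2 + b\<^sup>2\<close>. By self-adjointness the
  square contributes \<open>z \<bullet> z\<close> to the inner product with \<open>x\<close>, so
  only the \<open>b\<^sup>2\<close> term remains after Cauchy-Schwarz.\<close>

lemma quadratic_bounded_below:
  "b\<^sup>2 * norm x \<le> norm (poly_op [:a\<^sup>2 + b\<^sup>2, - 2 * a, 1:] A x)"
proof -
  define z where "z = A x - a *\<^sub>R x"
  have "poly_op [:a\<^sup>2 + b\<^sup>2, - 2 * a, 1:] A x = A z - a *\<^sub>R z + b\<^sup>2 *\<^sub>R x"
    by (simp add: z_def poly_op_simps linear_add[OF linear] linear_diff[OF linear] linear_scale[OF linear]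
        power2_eq_square algebra_simps flip: scaleR_2)
  moreover have "(A z - a *\<^sub>R z) \<bullet> x = z \<bullet> z"
    by (simp add: inner_diff_left self_adjoint) (simp add: z_def inner_diff_left inner_diff_right)
  ultimately have "b\<^sup>2 * norm x * norm x \<le> poly_op [:a\<^sup>2 + b\<^sup>2, - 2 * a, 1:] A x \<bullet> x"
    by (simp add: inner_add_left dot_square_norm power2_eq_square)
  also have "\<dots> \<le> norm (poly_op [:a\<^sup>2 + b\<^sup>2, - 2 * a, 1:] A x) * norm x" by (rule norm_cauchy_schwarz)
  finally show ?thesis by (cases "x = 0") auto
qed

text \<open>Lower bounds multiply under composition, so factors can be split off one by one; each
  linear factor has its root outside the interval.\<close>

lemma poly_op_bounded_below:
  assumes "\<And>t. t \<in> {0..onorm A} \<Longrightarrow> poly q t \<noteq> 0"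
  shows "\<exists>c>0. \<forall>x. c * norm x \<le> norm (poly_op q A x)"
  using assms
proof (induction "degree q" arbitrary: q rule: less_induct)
  case less
  show ?case
  proof (cases "degree q = 0")
    case True
    then obtain c where c: "q = [:c:]" by (rule degree_eq_zeroE)
    \<comment> \<open>The interval contains 0, so the constant polynomial is nonzero.\<close>
    with less.prems[of 0] onorm_pos_le[OF bounded_linear] have "c \<noteq> 0" by auto
    then show ?thesis by (intro exI[of _ "\<bar>c\<bar>"]) (simp add: c poly_op_simps)
  next
    case False
    then obtain g h where gh: "q = g * h" "degree h < degree q"
      "(\<exists>r. g = [:- r, 1:]) \<or> (\<exists>a b. b \<noteq> 0 \<and> g = [:a\<^sup>2 + b\<^sup>2, - 2 * a, 1:])"
      using real_poly_factor[of q] by blast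
    have "\<exists>c>0. \<forall>x. c * norm x \<le> norm (poly_op h A x)"
      using gh less.prems by (intro less.hyps) auto
    then obtain c where c: "c > 0" "\<And>x. c * norm x \<le> norm (poly_op h A x)" by blast
    have "\<exists>d>0. \<forall>x. d * norm x \<le> norm (poly_op g A x)"
      using gh(3)
    proof (elim disjE exE conjE)
      fix r assume g: "g = [:- r, 1:]"
      then have "r \<notin> {0..onorm A}" using less.prems[of r] gh(1) by auto
      then show ?thesis using shift_bounded_below[of r] by (simp add: g poly_op_simps)
    next
      fix a b :: real assume "b \<noteq> 0" and g: "g = [:a\<^sup>2 + b\<^sup>2, - 2 * a, 1:]"
      then show ?thesis using quadratic_bounded_below[of b _ a] by (intro exI[of _ "b\<^sup>2"]) auto
    qed
    then obtain d where d: "d > 0" "\<And>x. d * norm x \<le> norm (poly_op g A x)" by blast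
    have "d * c * norm x \<le> norm (poly_op q A x)" for x
      using mult_left_mono[OF c(2)[of x], of d] d(1) d(2)[of "poly_op h A x"]
      unfolding gh(1) poly_op_mult[OF linear] mult.assoc by linarith
    then show ?thesis using c(1) d(1) by (intro exI[of _ "d * c"]) auto
  qed
qed

text \<open>
  Were the norm \<open>\<beta>\<close> of the self-adjoint operator \<open>B = p(A)\<close> larger than \<open>m\<close>, the polynomial
  \<open>p\<^sup>2 - \<beta>\<^sup>2\<close> would have no root in the interval, so \<open>B\<^sup>2 - \<beta>\<^sup>2\<close> would be bounded below; but it is
  not, as one sees on unit vectors \<open>x\<close> with \<open>\<parallel>B x\<parallel>\<close> close to \<open>\<beta>\<close>.
\<close>
lemma onorm_poly_op_le:
  assumes bound: "\<And>t. t \<in> {0..onorm A} \<Longrightarrow> \<bar>poly p t\<bar> \<le> m"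
  shows "onorm (poly_op p A) \<le> m"
proof (rule ccontr)
  define \<beta> where "\<beta> = onorm (poly_op p A)"
  assume "\<not> ?thesis"
  then have "m < \<beta>" by (simp add: \<beta>_def)
  have "0 \<le> m" using bound[of 0] onorm_pos_le[OF bounded_linear] by force
  then have "\<beta> > 0" using \<open>m < \<beta>\<close> by simp
  have le: "norm (poly_op p A x) \<le> \<beta> * norm x" for x
    unfolding \<beta>_def by (intro onorm) auto
  have "poly (p * p - [:\<beta>\<^sup>2:]) t \<noteq> 0" if "t \<in> {0..onorm A}" for t
  proof -
    have "\<bar>poly p t\<bar>\<^sup>2 < \<beta>\<^sup>2" using bound[OF that] \<open>m < \<beta>\<close> \<open>\<beta> > 0\<close> by (intro power_strict_mono) auto
    then show ?thesis by (simp add: power2_eq_square)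
  qed
  then obtain c where c: "c > 0" "\<And>x. c * norm x \<le> norm (poly_op (p * p - [:\<beta>\<^sup>2:]) A x)"
    using poly_op_bounded_below by blast
  \<comment> \<open>Expanding the square of the norm of
    \<open>B\<^sup>2 x - \<beta>\<^sup>2 x\<close> and solving for that of \<open>B x\<close> gives
    this constant. It lies strictly below \<open>\<beta>\<^sup>2\<close>, contradicting that
    \<open>\<beta>\<close> is the operator norm.\<close>
  define k where "k = \<beta>\<^sup>2 - c\<^sup>2 / \<beta>\<^sup>2"
  have "(norm (poly_op p A x))\<^sup>2 \<le> k * (norm x)\<^sup>2" for x
  proof -
    define b where "b = poly_op p A x"
    have "(c * norm x)\<^sup>2 \<le> (norm (poly_op p A b - \<beta>\<^sup>2 *\<^sub>R x))\<^sup>2"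
      using c by (intro power_mono) (auto simp: b_def poly_op_simps)
    also have "\<dots> = (norm (poly_op p A b))\<^sup>2 - 2 * \<beta>\<^sup>2 * (poly_op p A b \<bullet> x) + \<beta>\<^sup>2 * \<beta>\<^sup>2 * (norm x)\<^sup>2"
      unfolding power2_norm_eq_inner by (simp add: inner_diff_left inner_diff_right inner_commute)
    also have "poly_op p A b \<bullet> x = (norm b)\<^sup>2"
      by (simp add: poly_op_self_adjoint power2_norm_eq_inner flip: b_def)
    also have "(norm (poly_op p A b))\<^sup>2 \<le> (\<beta> * norm b)\<^sup>2"
      using le by (intro power_mono) auto
    finally have "\<beta>\<^sup>2 * (norm b)\<^sup>2 \<le> \<beta>\<^sup>2 * \<beta>\<^sup>2 * (norm x)\<^sup>2 - c\<^sup>2 * (norm x)\<^sup>2"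
      by (simp add: power_mult_distrib)
    also have "\<dots> = \<beta>\<^sup>2 * (k * (norm x)\<^sup>2)" using \<open>\<beta> > 0\<close> by (simp add: k_def field_simps)
    finally show ?thesis using \<open>\<beta> > 0\<close> by (simp add: b_def)
  qed
  \<comment> \<open>Replacing \<open>k\<close> by \<open>max 0 k\<close> gives a nonnegative
    constant under the square root.\<close>
  then have "(norm (poly_op p A x))\<^sup>2 \<le> max 0 k * (norm x)\<^sup>2" for x
    using mult_right_mono[of k "max 0 k" "(norm x)\<^sup>2"] by (meson max.cobounded2 order_trans zero_le_power2)
  then have "norm (poly_op p A x) \<le> sqrt (max 0 k) * norm x" for x
    using real_le_rsqrt by (fastforce simp: real_sqrt_mult)
  then have "\<beta> \<le> sqrt (max 0 k)"
    unfolding \<beta>_def by (intro onorm_bound) auto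
  moreover have "sqrt (max 0 k) < sqrt (\<beta>\<^sup>2)"
    using \<open>\<beta> > 0\<close> c(1) by (intro real_sqrt_less_mono) (auto simp: k_def)
  ultimately show False using \<open>\<beta> > 0\<close> by simp
qed

lemma norm_poly_op_le:
  assumes "\<And>t. t \<in> {0..onorm A} \<Longrightarrow> \<bar>poly p t\<bar> \<le> m"
  shows "norm (poly_op p A x) \<le> m * norm x"
  using onorm[OF bounded_linear_poly, of p x] mult_right_mono[OF onorm_poly_op_le[OF assms], of "norm x"]
  by simp

text \<open>If \<open>p\<close> takes values between 0 and \<open>K\<close>, then
  \<open>K / 2 - p\<close> is bounded by \<open>K / 2\<close> in absolute value. The norm bound for
  this shifted polynomial is a one-sided bound for \<open>p\<close> itself.\<close>

lemma poly_op_nonneg: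
  assumes pos: "\<And>t. t \<in> {0..onorm A} \<Longrightarrow> 0 \<le> poly p t"
  shows "0 \<le> poly_op p A x \<bullet> x"
proof -
  have "bounded (poly p ` {0..onorm A})"
    by (intro compact_imp_bounded compact_continuous_image continuous_intros) auto
  then obtain K where K: "\<And>t. t \<in> {0..onorm A} \<Longrightarrow> \<bar>poly p t\<bar> \<le> K"
    unfolding bounded_iff real_norm_def by blast
  have "norm (poly_op ([:K / 2:] - p) A x) \<le> K / 2 * norm x"
  proof (rule norm_poly_op_le)
    fix t assume "t \<in> {0..onorm A}"
    then show "\<bar>poly ([:K / 2:] - p) t\<bar> \<le> K / 2"
      using pos[of t] K[of t] unfolding poly_diff by (simp add: abs_if split: if_splits)
  qed
  then have "norm (poly_op ([:K / 2:] - p) A x) * norm x \<le> K / 2 * norm x * norm x"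
    by (rule mult_right_mono) simp
  then have "poly_op ([:K / 2:] - p) A x \<bullet> x \<le> K / 2 * (norm x * norm x)"
    using norm_cauchy_schwarz[of "poly_op ([:K / 2:] - p) A x" x] by linarith
  then show ?thesis
    by (simp add: poly_op_simps inner_diff_left dot_square_norm power2_eq_square)
qed

end

section \<open>Uniform approximation and the continuous functional calculus\<close>

text \<open>Weierstrass approximation. It ensures that the quantifier over sequences in
  \<open>fun_calc\<close> is not vacuous, which uniqueness rests on.\<close>

lemma uniform_limit_poly:
  fixes f :: "real \<Rightarrow> real"
  assumes "compact S" "continuous_on S f"
  shows "\<exists>p. uniform_limit S (\<lambda>n. poly (p n)) f sequentially"
proof -
  have "\<exists>p. \<forall>t\<in>S. \<bar>f t - poly p t\<bar> < 1 / real (Suc n)" for n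
  proof -
    obtain g where g: "real_polynomial_function g" "\<And>t. t \<in> S \<Longrightarrow> \<bar>f t - g t\<bar> < 1 / real (Suc n)"
      using Stone_Weierstrass_real_polynomial_function[OF assms, of "1 / real (Suc n)"] by auto
    then obtain a k where "g = (\<lambda>x. \<Sum>i\<le>k. a i * x ^ i)"
      using real_polynomial_function_iff_sum by auto
    then have "g t = poly (\<Sum>i\<le>k. monom (a i) i) t" for t
      by (simp add: poly_sum poly_monom)
    then show ?thesis using g(2) by metis
  qed
  then obtain p where p: "\<And>n t. t \<in> S \<Longrightarrow> \<bar>f t - poly (p n) t\<bar> < 1 / real (Suc n)" by metis
  have "uniform_limit S (\<lambda>n. poly (p n)) f sequentially"
    unfolding uniform_limit_iff eventually_sequentially
  proof (intro allI impI)
    fix e :: real assume "e > 0"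
    then obtain N where N: "1 / real (Suc N) < e" using nat_approx_posE by metis
    have "dist (poly (p n) t) (f t) < e" if "n \<ge> N" "t \<in> S" for n t
    proof -
      have "1 / real (Suc n) \<le> 1 / real (Suc N)" using that by (intro divide_left_mono) auto
      then show ?thesis using p[OF that(2), of n] N by (simp add: dist_real_def abs_minus_commute)
    qed
    then show "\<exists>N. \<forall>n\<ge>N. \<forall>t\<in>S. dist (poly (p n) t) (f t) < e" by blast
  qed
  then show ?thesis by blast
qed

context positive_operator
begin

text \<open>\<open>norm_poly_op_le\<close> turns uniform closeness on the interval into closeness in
  operator norm. Completeness gives a pointwise limit \<open>B\<close>, and the estimates, uniform
  in \<open>u\<close>, pass to it.\<close>

lemma poly_op_onorm_convergent:
  assumes p: "uniform_limit {0..onorm A} (\<lambda>n. poly (p n)) f sequentially"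
  shows "\<exists>B. bounded_linear B \<and> (\<lambda>n. onorm (\<lambda>u. poly_op (p n) A u - B u)) \<longlonglongrightarrow> 0"
proof -
  have close: "\<exists>N. \<forall>m\<ge>N. \<forall>n\<ge>N. \<forall>u. norm (poly_op (p m) A u - poly_op (p n) A u) \<le> e * norm u"
    if "e > 0" for e
  proof -
    have "\<forall>\<^sub>F n in sequentially. \<forall>t\<in>{0..onorm A}. dist (poly (p n) t) (f t) < e / 2"
      using that by (intro uniform_limitD[OF p]) simp
    then obtain N where N: "\<And>n t. n \<ge> N \<Longrightarrow> t \<in> {0..onorm A} \<Longrightarrow> \<bar>poly (p n) t - f t\<bar> < e / 2"
      unfolding eventually_sequentially dist_real_def by blast
    have "norm (poly_op (p m - p n) A u) \<le> e * norm u" if "m \<ge> N" "n \<ge> N" for m n u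
    proof (rule norm_poly_op_le)
      fix t assume "t \<in> {0..onorm A}"
      then show "\<bar>poly (p m - p n) t\<bar> \<le> e"
        using N[of m t] N[of n t] that unfolding poly_diff by linarith
    qed
    then show ?thesis by (auto simp: poly_op_simps)
  qed
  have "Cauchy (\<lambda>n. poly_op (p n) A u)" for u
  proof (rule metric_CauchyI)
    fix e :: real assume "e > 0"
    then have pos: "e / (norm u + 1) > 0" by (simp add: add_nonneg_pos)
    have "e / (norm u + 1) * norm u < e"
      using \<open>e > 0\<close> by (simp add: pos_divide_less_eq add_nonneg_pos)
    then show "\<exists>M. \<forall>m\<ge>M. \<forall>n\<ge>M. dist (poly_op (p m) A u) (poly_op (p n) A u) < e"
      using close[OF pos] unfolding dist_norm by (meson le_less_trans)
  qed
  then obtain B where B: "\<And>u. (\<lambda>n. poly_op (p n) A u) \<longlonglongrightarrow> B u"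
    unfolding Cauchy_convergent_iff convergent_def by metis
  have lim: "\<exists>N. \<forall>n\<ge>N. \<forall>u. norm (poly_op (p n) A u - B u) \<le> e * norm u" if "e > 0" for e
  proof -
    obtain N where N: "\<And>m n u. m \<ge> N \<Longrightarrow> n \<ge> N \<Longrightarrow> norm (poly_op (p m) A u - poly_op (p n) A u) \<le> e * norm u"
      using close[OF \<open>e > 0\<close>] by blast
    have "norm (poly_op (p m) A u - B u) \<le> e * norm u" if "m \<ge> N" for m u
    proof (rule tendsto_upperbound)
      show "(\<lambda>n. norm (poly_op (p m) A u - poly_op (p n) A u)) \<longlonglongrightarrow> norm (poly_op (p m) A u - B u)"
        by (intro tendsto_intros B)
      show "\<forall>\<^sub>F n in sequentially. norm (poly_op (p m) A u - poly_op (p n) A u) \<le> e * norm u"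
        using N[OF that] by (auto simp: eventually_sequentially)
    qed simp
    then show ?thesis by blast
  qed
  have "bounded_linear B"
  proof -
    \<comment> \<open>A single polynomial within operator distance 1 of \<open>B\<close> makes
      \<open>B\<close> bounded.\<close>
    obtain N where N: "\<And>u. norm (poly_op (p N) A u - B u) \<le> norm u" using lim[of 1] by auto
    show ?thesis
    proof (rule bounded_linear_intro)
      fix u v and c :: real
      have "(\<lambda>n. poly_op (p n) A (u + v)) \<longlonglongrightarrow> B u + B v"
        by (simp add: linear_add[OF bounded_linear.linear[OF bounded_linear_poly]] tendsto_add B)
      then show "B (u + v) = B u + B v" by (rule LIMSEQ_unique[OF B])
      have "(\<lambda>n. poly_op (p n) A (c *\<^sub>R u)) \<longlonglongrightarrow> c *\<^sub>R B u"
        by (simp add: linear_scale[OF bounded_linear.linear[OF bounded_linear_poly]] tendsto_scaleR B)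
      then show "B (c *\<^sub>R u) = c *\<^sub>R B u" by (rule LIMSEQ_unique[OF B])
      show "norm (B u) \<le> norm u * (1 + onorm (poly_op (p N) A))"
        using N[of u] onorm[OF bounded_linear_poly, of "p N" u]
          norm_triangle_ineq4[of "poly_op (p N) A u" "poly_op (p N) A u - B u"]
        by (simp add: algebra_simps)
    qed
  qed
  moreover have "(\<lambda>n. onorm (\<lambda>u. poly_op (p n) A u - B u)) \<longlonglongrightarrow> 0"
  proof (rule LIMSEQ_I)
    fix e :: real assume "e > 0"
    then obtain N where N: "\<And>n u. n \<ge> N \<Longrightarrow> norm (poly_op (p n) A u - B u) \<le> e / 2 * norm u"
      using lim[of "e / 2"] by auto
    have "norm (onorm (\<lambda>u. poly_op (p n) A u - B u) - 0) < e" if "n \<ge> N" for n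
    proof -
      have "onorm (\<lambda>u. poly_op (p n) A u - B u) \<le> e / 2"
        using N[OF that] \<open>e > 0\<close> by (intro onorm_bound) auto
      moreover have "0 \<le> onorm (\<lambda>u. poly_op (p n) A u - B u)"
        by (intro onorm_pos_le bounded_linear_sub \<open>bounded_linear B\<close> bounded_linear_poly)
      ultimately show ?thesis using \<open>e > 0\<close> by simp
    qed
    then show "\<exists>N. \<forall>n\<ge>N. norm (onorm (\<lambda>u. poly_op (p n) A u - B u) - 0) < e" by blast
  qed
  ultimately show ?thesis by blast
qed

lemma tendsto_onorm_imp_tendsto:
  assumes "bounded_linear B" "(\<lambda>n. onorm (\<lambda>u. poly_op (p n) A u - B u)) \<longlonglongrightarrow> 0"
  shows "(\<lambda>n. poly_op (p n) A u) \<longlonglongrightarrow> B u"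
proof (rule Lim_transform2[OF tendsto_const])
  have "norm (B u - poly_op (p n) A u) \<le> onorm (\<lambda>u. poly_op (p n) A u - B u) * norm u" for n
    using onorm[OF bounded_linear_sub[OF bounded_linear_poly assms(1)], of "p n" u]
    by (simp add: norm_minus_commute)
  moreover have "(\<lambda>n. onorm (\<lambda>u. poly_op (p n) A u - B u) * norm u) \<longlonglongrightarrow> 0"
    using tendsto_mult_right[OF assms(2), of "norm u"] by simp
  ultimately show "(\<lambda>n. B u - poly_op (p n) A u) \<longlonglongrightarrow> 0"
    by (rule Lim_null_comparison[OF always_eventually[OF allI]])
qed

text \<open>
  Interlacing two approximating sequences gives a third, which converges in operator norm; hence
  both have the same limit.
\<close>
lemma fun_calc_works:
  assumes "continuous_on {0..onorm A} f"
  shows "bounded_linear (fun_calc f A)"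
    and "uniform_limit {0..onorm A} (\<lambda>n. poly (p n)) f sequentially \<Longrightarrow>
      (\<lambda>n. onorm (\<lambda>u. poly_op (p n) A u - fun_calc f A u)) \<longlonglongrightarrow> 0"
proof -
  let ?approx = "\<lambda>p. uniform_limit {0..onorm A} (\<lambda>n. poly (p n)) f sequentially"
  let ?lim = "\<lambda>p B. (\<lambda>n. onorm (\<lambda>u. poly_op (p n) A u - B u)) \<longlonglongrightarrow> 0"
  let ?P = "\<lambda>B. bounded_linear B \<and> (\<forall>p. ?approx p \<longrightarrow> ?lim p B)"
  obtain p where p: "?approx p"
    using uniform_limit_poly[OF _ assms] by auto
  then obtain B where B: "bounded_linear B" "?lim p B"
    using poly_op_onorm_convergent by blast
  have "?lim q B" if q: "?approx q" for q
  proof -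
    define s where "s n = (if even n then p (n div 2) else q (n div 2))" for n
    have "?approx s"
      unfolding uniform_limit_iff
    proof (intro allI impI)
      fix e :: real assume "e > 0"
      then obtain M N where
        "\<And>n t. n \<ge> M \<Longrightarrow> t \<in> {0..onorm A} \<Longrightarrow> dist (poly (p n) t) (f t) < e"
        "\<And>n t. n \<ge> N \<Longrightarrow> t \<in> {0..onorm A} \<Longrightarrow> dist (poly (q n) t) (f t) < e"
        using uniform_limitD[OF p] uniform_limitD[OF q] unfolding eventually_sequentially by metis
      then show "\<forall>\<^sub>F n in sequentially. \<forall>t\<in>{0..onorm A}. dist (poly (s n) t) (f t) < e"
        \<comment> \<open>From \<open>2 * (M + N)\<close> on, \<open>n div 2\<close> exceeds or
          equals both thresholds.\<close>
        unfolding eventually_sequentially s_def by (intro exI[of _ "2 * (M + N)"]) auto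
    qed
    then obtain C where C: "bounded_linear C" "?lim s C"
      using poly_op_onorm_convergent by blast
    have "?lim p C"
      using LIMSEQ_subseq_LIMSEQ[OF C(2), of "\<lambda>n. 2 * n"] by (simp add: s_def o_def strict_mono_def)
    \<comment> \<open>The even-indexed terms identify \<open>C\<close> with \<open>B\<close>; the
      odd-indexed ones then carry the convergence over to \<open>q\<close>.\<close>
    then have "C = B"
      using tendsto_onorm_imp_tendsto B C(1) LIMSEQ_unique by blast
    then show ?thesis
      using LIMSEQ_subseq_LIMSEQ[OF C(2), of "\<lambda>n. 2 * n + 1"] by (simp add: s_def o_def strict_mono_def)
  qed
  with B(1) have "?P B" by blast
  moreover have "B' = B" if "?P B'" for B'
    using tendsto_onorm_imp_tendsto[OF B] tendsto_onorm_imp_tendsto[of B' p] that p LIMSEQ_unique by blast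
  ultimately have "?P (fun_calc f A)" unfolding fun_calc_def by (rule theI)
  then show "bounded_linear (fun_calc f A)" and "?approx p \<Longrightarrow> ?lim p (fun_calc f A)" for p by blast+
qed

lemma tendsto_fun_calc:
  assumes "continuous_on {0..onorm A} f" "uniform_limit {0..onorm A} (\<lambda>n. poly (p n)) f sequentially"
  shows "(\<lambda>n. poly_op (p n) A u) \<longlonglongrightarrow> fun_calc f A u"
  using assms by (intro tendsto_onorm_imp_tendsto fun_calc_works)

section \<open>Powers of a positive operator and interpolation\<close>

lemma continuous_on_powr_const: "r > 0 \<Longrightarrow> continuous_on {0..onorm A} (\<lambda>t. t powr r)"
  by (intro continuous_on_powr') (auto intro!: continuous_intros)

lemma op_powr_approx:
  assumes "r > 0"
  obtains p where "uniform_limit {0..onorm A} (\<lambda>n. poly (p n)) (\<lambda>t. t powr r) sequentially"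
    "\<And>u. (\<lambda>n. poly_op (p n) A u) \<longlonglongrightarrow> op_powr A r u"
  using uniform_limit_poly[OF _ continuous_on_powr_const[OF assms]]
    tendsto_fun_calc[OF continuous_on_powr_const[OF assms]] unfolding op_powr_def by blast

lemma op_powr_self_adjoint:
  assumes "r > 0"
  shows "op_powr A r x \<bullet> y = x \<bullet> op_powr A r y"
proof -
  obtain p where p: "\<And>u. (\<lambda>n. poly_op (p n) A u) \<longlonglongrightarrow> op_powr A r u"
    using op_powr_approx[OF assms] by blast
  have "(\<lambda>n. poly_op (p n) A x \<bullet> y) \<longlonglongrightarrow> op_powr A r x \<bullet> y"
    "(\<lambda>n. x \<bullet> poly_op (p n) A y) \<longlonglongrightarrow> x \<bullet> op_powr A r y"
    by (intro tendsto_intros p)+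
  then show ?thesis by (simp add: poly_op_self_adjoint LIMSEQ_unique)
qed

lemma op_powr_1: "op_powr A 1 = A"
proof
  fix u
  \<comment> \<open>On the interval \<open>t powr 1 = t\<close>, so a constant sequence
    approximates.\<close>
  have "uniform_limit {0..onorm A} (\<lambda>n. poly [:0, 1:]) (\<lambda>t. t powr 1) sequentially"
    by (auto simp: uniform_limit_iff)
  then have "(\<lambda>n::nat. poly_op [:0, 1:] A u) \<longlonglongrightarrow> op_powr A 1 u"
    unfolding op_powr_def by (intro tendsto_fun_calc continuous_on_powr_const) auto
  then show "op_powr A 1 u = A u"
    by (simp add: poly_op_simps LIMSEQ_const_iff)
qed

text \<open>
  For \<open>s > 0\<close> the concave function \<open>x powr r\<close> lies below its tangent at \<open>x = s\<close>; inserting \<open>x = t\<^sup>2\<close>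
  bounds \<open>t powr (2 * r)\<close> by a quadratic polynomial in \<open>t\<close>.
\<close>
lemma op_powr_tangent_bound:
  assumes "0 < r" "r \<le> 1" "0 < s"
  shows "(norm (op_powr A r u))\<^sup>2 \<le> r * s powr (r - 1) * (norm (A u))\<^sup>2 + (1 - r) * s powr r * (norm u)\<^sup>2"
proof -
  define a b where "a = r * s powr (r - 1)" and "b = (1 - r) * s powr r"
  have tangent: "(t powr r)\<^sup>2 \<le> a * t\<^sup>2 + b" if "t \<ge> 0" for t
  proof (cases "t = 0")
    case False
    with that have "t > 0" by simp
    \<comment> \<open>The tangent bound is Young's inequality for \<open>t\<^sup>2 / s\<close> and 1
      with weights \<open>r\<close> and \<open>1 - r\<close>.\<close>
    have "(t powr r)\<^sup>2 = (t\<^sup>2 / s) powr r * 1 powr (1 - r) * s powr r"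
      using \<open>t > 0\<close> \<open>s > 0\<close> by (simp add: powr_divide powr_mult power2_eq_square)
    also have "\<dots> \<le> (r * (t\<^sup>2 / s) + (1 - r) * 1) * s powr r"
      using assms \<open>t > 0\<close> by (intro mult_right_mono Youngs_inequality_0) auto
    also have "\<dots> = a * t\<^sup>2 + b"
      using \<open>s > 0\<close> by (simp add: a_def b_def powr_diff field_simps)
    finally show ?thesis .
  qed (use assms in \<open>simp add: b_def\<close>)
  obtain p where unif: "uniform_limit {0..onorm A} (\<lambda>n. poly (p n)) (\<lambda>t. t powr r) sequentially"
    and p: "\<And>u. (\<lambda>n. poly_op (p n) A u) \<longlonglongrightarrow> op_powr A r u"
    using op_powr_approx[OF assms(1)] by blast
  \<comment> \<open>Boundedness of the limit function lets uniform convergence survive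
    squaring.\<close>
  have "bounded ((\<lambda>t. t powr r) ` {0..onorm A})"
    using assms(1) by (intro compact_imp_bounded compact_continuous_image continuous_on_powr_const) auto
  then have sq: "uniform_limit {0..onorm A} (\<lambda>n t. (poly (p n) t)\<^sup>2) (\<lambda>t. (t powr r)\<^sup>2) sequentially"
    unfolding power2_eq_square by (intro uniform_lim_mult unif)
  have "(norm (op_powr A r u))\<^sup>2 \<le> a * (norm (A u))\<^sup>2 + b * (norm u)\<^sup>2 + e * (norm u)\<^sup>2" if "e > 0" for e
  proof (rule tendsto_upperbound)
    show "(\<lambda>n. (norm (poly_op (p n) A u))\<^sup>2) \<longlonglongrightarrow> (norm (op_powr A r u))\<^sup>2"
      by (intro tendsto_intros p)
    show "\<forall>\<^sub>F n in sequentially. (norm (poly_op (p n) A u))\<^sup>2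
        \<le> a * (norm (A u))\<^sup>2 + b * (norm u)\<^sup>2 + e * (norm u)\<^sup>2"
      using uniform_limitD[OF sq \<open>e > 0\<close>]
    proof eventually_elim
      case (elim n)
      \<comment> \<open>The slack \<open>e\<close> absorbs the approximation error, so the
        comparison is between polynomials.\<close>
      have "0 \<le> poly ([:b + e, 0, a:] - p n * p n) t" if "t \<in> {0..onorm A}" for t
      proof -
        have "\<bar>(poly (p n) t)\<^sup>2 - (t powr r)\<^sup>2\<bar> < e" using elim that by (auto simp: dist_real_def)
        moreover have "poly ([:b + e, 0, a:] - p n * p n) t = b + e + a * t\<^sup>2 - (poly (p n) t)\<^sup>2"
          by (simp add: power2_eq_square algebra_simps)
        ultimately show ?thesis using tangent[of t] that by simp
      qed
      then have "0 \<le> poly_op ([:b + e, 0, a:] - p n * p n) A u \<bullet> u" by (rule poly_op_nonneg)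
      then show ?case
        by (simp add: poly_op_simps linear_scale[OF linear] inner_diff_left inner_add_left self_adjoint
            poly_op_self_adjoint power2_norm_eq_inner algebra_simps)
    qed
  qed simp
  then have "(norm (op_powr A r u))\<^sup>2 \<le> a * (norm (A u))\<^sup>2 + b * (norm u)\<^sup>2 + e" if "e > 0" for e
  proof -
    have "(norm u)\<^sup>2 + 1 > 0" by (simp add: add_nonneg_pos)
    then have "e / ((norm u)\<^sup>2 + 1) * (norm u)\<^sup>2 \<le> e" "e / ((norm u)\<^sup>2 + 1) > 0"
      using that by (auto simp: pos_divide_le_eq)
    then show ?thesis
      using \<open>\<And>e. e > 0 \<Longrightarrow> (norm (op_powr A r u))\<^sup>2 \<le> a * (norm (A u))\<^sup>2 + b * (norm u)\<^sup>2 + e * (norm u)\<^sup>2\<close>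
      by (meson add_left_mono order_trans)
  qed
  then show ?thesis unfolding a_def b_def by (rule field_le_epsilon)
qed

text \<open>Optimise \<open>op_powr_tangent_bound\<close> over \<open>s\<close>: the minimiser is
  the square of \<open>norm (A u) / norm u\<close>. If \<open>A u = 0\<close>, the bound tends to 0
  with \<open>s\<close>.\<close>

lemma interpolation:
  assumes "0 < r" "r < 1"
  shows "norm (op_powr A r u) \<le> norm (A u) powr r * norm u powr (1 - r)"
proof (cases "A u = 0")
  case True
  have "(norm (op_powr A r u))\<^sup>2 \<le> e" if "e > 0" for e
  proof -
    \<comment> \<open>Only the term in \<open>s powr r\<close> survives, and
      \<open>s powr r = q\<close> makes it at most \<open>e\<close>.\<close>
    define q where "q = e / ((norm u)\<^sup>2 + 1)"
    define s where "s = q powr (1 / r)"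
    have pos: "(norm u)\<^sup>2 + 1 > 0" by (simp add: add_nonneg_pos)
    then have "q > 0" using that by (simp add: q_def)
    then have s: "s > 0" "s powr r = q"
      using assms by (simp_all add: s_def powr_powr)
    have "(norm (op_powr A r u))\<^sup>2 \<le> (1 - r) * (s powr r * (norm u)\<^sup>2)"
      using op_powr_tangent_bound[of r s u] assms s(1) True by simp
    also have "\<dots> \<le> 1 * (s powr r * (norm u)\<^sup>2)" using assms by (intro mult_right_mono) auto
    also have "\<dots> \<le> e" using that pos unfolding s(2) q_def by (simp add: pos_divide_le_eq)
    finally show ?thesis .
  qed
  then have "(norm (op_powr A r u))\<^sup>2 \<le> 0" by (metis dense_ge)
  then show ?thesis by simp
next
  case False
  then have "u \<noteq> 0" using linear_0[OF linear] by auto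
  define x y where "x = (norm (A u))\<^sup>2" and "y = (norm u)\<^sup>2"
  have pos: "x > 0" "y > 0" using False \<open>u \<noteq> 0\<close> by (auto simp: x_def y_def)
  have "(norm (op_powr A r u))\<^sup>2 \<le> r * (x / y) powr (r - 1) * x + (1 - r) * (x / y) powr r * y"
    using op_powr_tangent_bound[of r "x / y" u] assms pos by (simp add: x_def y_def)
  also have "\<dots> = x powr r * y powr (1 - r)"
    using pos by (simp add: powr_divide powr_diff field_simps)
  also have "\<dots> = (norm (A u) powr r * norm u powr (1 - r))\<^sup>2"
    using False \<open>u \<noteq> 0\<close> by (simp add: x_def y_def power2_eq_square powr_mult)
  finally show ?thesis by (rule power2_le_imp_le) simp
qed

end

section \<open>The operator \<open>adjoint L \<circ> L\<close> and the two implications\<close>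

text \<open>All properties come from the inner-product identity of the adjoint: linearity by testing
  against every vector, boundedness by testing against the image \<open>z\<close> itself.\<close>

lemma positive_operator_adjoint_comp:
  fixes L :: "'u::{real_inner, complete_space} \<Rightarrow> 'v::{real_inner, complete_space}"
  assumes L: "bounded_linear L"
  shows "positive_operator (adjoint L \<circ> L)"
proof (rule positive_operator.intro)
  interpret L: bounded_linear L by fact
  note adj = bounded_linear_inner_adjoint[OF L]
  note adj' = adj[symmetric]
  show sa: "(adjoint L \<circ> L) x \<bullet> y = x \<bullet> (adjoint L \<circ> L) y" for x y
    by (metis adj comp_apply inner_commute)
  show "0 \<le> (adjoint L \<circ> L) x \<bullet> x" for x
    by (simp add: inner_commute[of _ x] adj')
  have adj_eqI: "v = w" if "\<And>x. x \<bullet> v = x \<bullet> w" for v w :: 'u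
    using that[of "v - w"] inner_diff_right[of "v - w" v w] by simp
  show "bounded_linear (adjoint L \<circ> L)"
  proof (rule bounded_linear_intro)
    fix x y :: 'u and c :: real
    show "(adjoint L \<circ> L) (x + y) = (adjoint L \<circ> L) x + (adjoint L \<circ> L) y"
      by (rule adj_eqI) (simp add: adj' L.add inner_add_right)
    show "(adjoint L \<circ> L) (c *\<^sub>R x) = c *\<^sub>R (adjoint L \<circ> L) x"
      by (rule adj_eqI) (simp add: adj' L.scaleR)
    define z where "z = adjoint L (L x)"
    have "norm z * norm z = L z \<bullet> L x" by (simp add: adj z_def dot_square_norm power2_eq_square)
    also have "\<dots> \<le> norm (L z) * norm (L x)" by (rule norm_cauchy_schwarz)
    also have "\<dots> \<le> (onorm L * norm z) * (onorm L * norm x)"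
      by (intro mult_mono onorm L mult_nonneg_nonneg onorm_pos_le) auto
    also have "\<dots> = norm x * (onorm L * onorm L) * norm z" by (simp add: mult_ac)
    finally have "norm z \<le> norm x * (onorm L * onorm L)"
      using onorm_pos_le[OF L] by (cases "z = 0") (auto intro: mult_right_le_imp_le)
    then show "norm ((adjoint L \<circ> L) x) \<le> norm x * (onorm L * onorm L)" by (simp add: z_def)
  qed
qed

lemma source_condition_imp_symmetrized_vi:
  fixes L :: "'u::{real_inner, complete_space} \<Rightarrow> 'v::{real_inner, complete_space}"
  assumes L: "bounded_linear L" and \<nu>: "0 < \<nu>" "\<nu> \<le> 2" and source: "source_condition L x \<nu>"
  shows "symmetrized_vi L x \<nu>"
proof -
  interpret positive_operator "adjoint L \<circ> L" by (rule positive_operator_adjoint_comp[OF L])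
  let ?R = "op_powr (adjoint L \<circ> L) (\<nu> / 2)"
  obtain w where w: "x = ?R w" using source by (auto simp: source_condition_def)
  \<comment> \<open>The endpoint \<open>\<nu> = 2\<close> is \<open>op_powr_1\<close>; smaller
    \<open>\<nu>\<close> use interpolation.\<close>
  have bound: "norm (?R u) \<le> norm (adjoint L (L u)) powr (\<nu> / 2) *
      (if \<nu> = 2 then 1 else norm u powr (1 - \<nu> / 2))" for u
    using interpolation[of "\<nu> / 2" u] \<nu> by (auto simp: op_powr_1)
  have "2 * (x \<bullet> u) \<le> 2 * norm w * norm (adjoint L (L u)) powr (\<nu> / 2) *
      (if \<nu> = 2 then 1 else norm u powr (1 - \<nu> / 2))" for u
  proof -
    have "x \<bullet> u = w \<bullet> ?R u" using \<nu> by (simp add: w op_powr_self_adjoint)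
    also have "\<dots> \<le> norm w * norm (?R u)" by (rule norm_cauchy_schwarz)
    also have "\<dots> \<le> norm w * (norm (adjoint L (L u)) powr (\<nu> / 2) *
      (if \<nu> = 2 then 1 else norm u powr (1 - \<nu> / 2)))"
      by (intro mult_left_mono bound) auto
    finally show ?thesis by (simp add: mult.assoc)
  qed
  then show ?thesis unfolding symmetrized_vi_def by (intro exI[of _ "2 * norm w"]) auto
qed

lemma symmetrized_vi_2_imp_source_condition:
  fixes L :: "'u::{real_inner, complete_space} \<Rightarrow> 'v::{real_inner, complete_space}"
  assumes L: "bounded_linear L" and vi: "symmetrized_vi L x 2"
  shows "source_condition L x 2"
proof -
  interpret positive_operator "adjoint L \<circ> L" by (rule positive_operator_adjoint_comp[OF L])
  let ?A = "adjoint L \<circ> L"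
  obtain \<beta> where \<beta>: "\<And>u. 2 * (x \<bullet> u) \<le> \<beta> * norm (?A u)"
    using vi by (auto simp: symmetrized_vi_def)
  \<comment> \<open>The one-sided inequality at \<open>u\<close> and at \<open>- u\<close> bounds
    the absolute value.\<close>
  have "\<bar>x \<bullet> u\<bar> \<le> \<beta> / 2 * norm (?A u)" for u
  proof -
    have "norm (?A (- u)) = norm (?A u)" unfolding linear_neg[OF linear] by (rule norm_minus_cancel)
    then show ?thesis using \<beta>[of u] \<beta>[of "- u"] by (simp add: abs_le_iff)
  qed
  then have "\<exists>w. \<forall>u. x \<bullet> u = w \<bullet> ?A u"
    by (rule functional_factors_through_range[OF linear, rotated])
      (auto intro!: linearI simp: inner_add_right)
  then obtain w where "\<And>u. x \<bullet> u = w \<bullet> ?A u" by blast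
  \<comment> \<open>Self-adjointness moves the operator onto \<open>w\<close>, so
    \<open>x - ?A w\<close> is orthogonal to everything.\<close>
  then have "(x - ?A w) \<bullet> u = 0" for u by (metis inner_diff_left self_adjoint eq_iff_diff_eq_0)
  then have "x = ?A w" by (metis inner_eq_zero_iff eq_iff_diff_eq_0)
  then show ?thesis by (simp add: source_condition_def op_powr_1)
qed

theorem lemma3:
  fixes L :: "'u::{real_inner, complete_space} \<Rightarrow> 'v::{real_inner, complete_space}"
    and y :: 'v
  assumes "bounded_linear L"
    and "y \<in> range L"
  shows "(\<forall>\<nu>::real. 0 < \<nu> \<and> \<nu> \<le> 2 \<longrightarrow>
            source_condition L (min_norm_solution L y) \<nu> \<longrightarrow>
            symmetrized_vi L (min_norm_solution L y) \<nu>) \<and>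
         (symmetrized_vi L (min_norm_solution L y) 2 \<longleftrightarrow>
            source_condition L (min_norm_solution L y) 2)"
  using source_condition_imp_symmetrized_vi[OF assms(1)]
    symmetrized_vi_2_imp_source_condition[OF assms(1)] by auto

end
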